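(* Let $A$ be a finite set of alternatives with $|A|\ge 4$. There is no voting procedure $V$ for $A$ that satisfies both the social disappointment criterion (SDC) and the Condorcet winner criterion (CWC).
   Context: Let $A$ be a finite set of alternatives. A ballot is a linear ordering of $A$ (a strict ranking without ties). For a positive integer $n$ with voter set $N=\{1,\dots,n\}$, an $(A,n)$-profile $P$ is an $n$-tuple of ballots, one per voter. A voting procedure $V$ for $A$ assigns to every positive integer $n$ and every $(A,n)$-profile $P$ a subset $V(P)\subseteq A$ (possibly empty, ties allowed). For a profile $P$ and $x,y\in A$, $W(x,y,P)$ is the number of voters who rank $x$ strictly above $y$ in $P$. The winners of Condorcet's method at $P$ are the alternatives $x$ with $W(x,y,P)\ge W(y,x,P)$ for all $y\in A$. An alternative $x$ is a Condorcet winner at $P$ if it is the unique winner of Condorcet's method at $P$. CWC: for every $n$ and every $(A,n)$-profile $P$, if $x$ is a Condorcet winner at $P$ then $V(P)=\{x\}$. SDC: for every $n$, every $(A,n)$-profile $P$ and every $x\in A$, if at least $n/2$ of the $n$ voters rank $x$ last (at the bottom of their ballot), then $x\notin V(P)$. *)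

theory Defs
  imports Complex_Main "HOL-Library.FuncSet"
begin

(* Orientation: (x, y) \<in> r means that x is ranked at or below y, so the
   favourite alternative of a ballot is its greatest element. *)
definition ballots :: "'a set \<Rightarrow> 'a rel set" where
  "ballots A = {r. linear_order_on A r}"

definition ranks_above :: "'a rel \<Rightarrow> 'a \<Rightarrow> 'a \<Rightarrow> bool" where
  "ranks_above r x y \<longleftrightarrow> (y, x) \<in> r \<and> x \<noteq> y"

definition ranks_last :: "'a set \<Rightarrow> 'a rel \<Rightarrow> 'a \<Rightarrow> bool" where
  "ranks_last A r x \<longleftrightarrow> x \<in> A \<and> (\<forall>y\<in>A - {x}. ranks_above r y x)"

(* The extensional function space makes profiles n-tuples: a voting procedure
   cannot depend on values outside the voter set. *)
definition profiles :: "'a set \<Rightarrow> nat \<Rightarrow> (nat \<Rightarrow> 'a rel) set" where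
  "profiles A n = {1..n} \<rightarrow>\<^sub>E ballots A"

definition voting_procedure :: "'a set \<Rightarrow> (nat \<Rightarrow> (nat \<Rightarrow> 'a rel) \<Rightarrow> 'a set) \<Rightarrow> bool" where
  "voting_procedure A V \<longleftrightarrow> (\<forall>n>0. \<forall>P\<in>profiles A n. V n P \<subseteq> A)"

definition W :: "nat \<Rightarrow> 'a \<Rightarrow> 'a \<Rightarrow> (nat \<Rightarrow> 'a rel) \<Rightarrow> nat" where
  "W n x y P = card {i \<in> {1..n}. ranks_above (P i) x y}"

definition condorcet_method :: "'a set \<Rightarrow> nat \<Rightarrow> (nat \<Rightarrow> 'a rel) \<Rightarrow> 'a set" where
  "condorcet_method A n P = {x \<in> A. \<forall>y\<in>A. W n x y P \<ge> W n y x P}"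

definition condorcet_winner :: "'a set \<Rightarrow> nat \<Rightarrow> (nat \<Rightarrow> 'a rel) \<Rightarrow> 'a \<Rightarrow> bool" where
  "condorcet_winner A n P x \<longleftrightarrow> condorcet_method A n P = {x}"

definition CWC :: "'a set \<Rightarrow> (nat \<Rightarrow> (nat \<Rightarrow> 'a rel) \<Rightarrow> 'a set) \<Rightarrow> bool" where
  "CWC A V \<longleftrightarrow>
     (\<forall>n>0. \<forall>P\<in>profiles A n. \<forall>x\<in>A. condorcet_winner A n P x \<longrightarrow> V n P = {x})"

definition SDC :: "'a set \<Rightarrow> (nat \<Rightarrow> (nat \<Rightarrow> 'a rel) \<Rightarrow> 'a set) \<Rightarrow> bool" where
  "SDC A V \<longleftrightarrow>
     (\<forall>n>0. \<forall>P\<in>profiles A n. \<forall>x\<in>A.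
        real (card {i \<in> {1..n}. ranks_last A (P i) x}) \<ge> real n / 2 \<longrightarrow> x \<notin> V n P)"

end

(* SDC and CWC already conflict on six voters.  The alternative x is first on three ballots and last
   on the other three, so it ties with everyone and SDC excludes it.  Three further alternatives
   a, b, c form a strict majority cycle, and all remaining alternatives are always below them; hence
   nobody else wins Condorcet's method, and CWC forces x to be elected. *)
theory Submission
  imports Defs
begin

text \<open>Ballots come from numerical scores, higher being better, so that every majority count
  becomes integer arithmetic. Injectivity of the score on \<open>A\<close> is what rules out
  ties.\<close>

definition score_ballot :: "'a set \<Rightarrow> ('a \<Rightarrow> int) \<Rightarrow> 'a rel" where
  "score_ballot A f = {(u, v). u \<in> A \<and> v \<in> A \<and> f u \<le> f v}"

lemma score_ballot_in_ballots:
  assumes "inj_on f A"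
  shows "score_ballot A f \<in> ballots A"
  using assms
  unfolding ballots_def score_ballot_def linear_order_on_def partial_order_on_def preorder_on_def
    refl_on_def trans_on_def antisym_def total_on_def inj_on_def
  by force

lemma ranks_above_score_ballot:
  assumes "inj_on f A" "u \<in> A" "v \<in> A"
  shows "ranks_above (score_ballot A f) u v \<longleftrightarrow> f v < f u"
  using assms unfolding ranks_above_def score_ballot_def
  by (auto simp: order_less_le inj_on_def)

lemma ranks_last_score_ballot:
  assumes "inj_on f A" "u \<in> A"
  shows "ranks_last A (score_ballot A f) u \<longleftrightarrow> (\<forall>v\<in>A - {u}. f u < f v)"
  using assms by (auto simp: ranks_last_def ranks_above_score_ballot)

lemma score_profile_in_profiles:
  assumes "\<And>i. inj_on (s i) A"
  shows "(\<lambda>i\<in>{1..n}. score_ballot A (s i)) \<in> profiles A n"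
  using assms by (auto simp: profiles_def score_ballot_in_ballots)

lemma W_score_profile:
  assumes "\<And>i. inj_on (s i) A" "u \<in> A" "v \<in> A"
  shows "W n u v (\<lambda>i\<in>{1..n}. score_ballot A (s i)) = card {i \<in> {1..n}. s i v < s i u}"
  unfolding W_def
  by (rule arg_cong[where f = card]) (auto simp: ranks_above_score_ballot[OF assms])

text \<open>An explicit six-term sum can be evaluated by simp, voter by voter.\<close>

lemma card_filter_six:
  "card {i \<in> {1..6::nat}. Q i} = (\<Sum>i\<in>{1,2,3,4,5,6}. if Q i then 1 else 0)"
proof -
  have "{1..6::nat} = {1,2,3,4,5,6}" by auto
  then show ?thesis by (simp only: card_eq_sum sum.inter_filter finite_insert finite.emptyI)
qed

lemma condorcet_winner_half_last:
  assumes "finite A" "card A \<ge> 4"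
  obtains P x where "P \<in> profiles A 6" "x \<in> A" "condorcet_winner A 6 P x"
    "card {i \<in> {1..6}. ranks_last A (P i) x} = 3"
proof -
  obtain B where "B \<subseteq> A" "card B = 4"
    using assms obtain_subset_with_card_n by metis
  then obtain x a b c where B: "B = {x, a, b, c}" and
    dist: "x \<noteq> a" "x \<noteq> b" "x \<noteq> c" "a \<noteq> b" "a \<noteq> c" "b \<noteq> c"
    by (auto simp: card_Suc_eq numeral_eq_Suc)
  with \<open>B \<subseteq> A\<close> have mem: "x \<in> A" "a \<in> A" "b \<in> A" "c \<in> A" by auto
  obtain g :: "'a \<Rightarrow> nat" and m where "g ` A = {i. i < m}" and g: "inj_on g A"
    using finite_imp_inj_to_nat_seg[OF assms(1)] by blast
  then have gm: "g y < m" if "y \<in> A" for y using that by blast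
  \<comment> \<open>Three bands: \<open>g\<close> puts the remaining alternatives in 0..m-1, a
    rotation mod 3 puts \<open>a\<close>, \<open>b\<close>, \<open>c\<close> in m..m+2, and the
    parity of \<open>i\<close> puts \<open>x\<close> below or above all of them. Voters 1..6 meet
    each pair of parity and residue mod 3 exactly once.\<close>
  define s :: "nat \<Rightarrow> 'a \<Rightarrow> int" where "s i y =
    (if y = x then if even i then -1 else int m + 3
     else if y = a then int m + int (i mod 3)
     else if y = b then int m + int ((i + 1) mod 3)
     else if y = c then int m + int ((i + 2) mod 3)
     else int (g y))" for i y
  have s_x: "s i x = (if even i then -1 else int m + 3)"
    and s_a: "s i a = int m + int (i mod 3)"
    and s_b: "s i b = int m + int ((i + 1) mod 3)"
    and s_c: "s i c = int m + int ((i + 2) mod 3)"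
    and s_other: "y \<notin> {x, a, b, c} \<Longrightarrow> s i y = int (g y)" for i y
    using dist by (auto simp: s_def)
  have range: "0 \<le> s i y \<and> s i y < int m + 3" if "y \<in> A" "y \<noteq> x" for i y
    using gm[OF that(1)] that(2) by (auto simp: s_def)
  have x_above: "s i y < s i x \<longleftrightarrow> odd i" and x_below: "s i x < s i y \<longleftrightarrow> even i"
    if "y \<in> A" "y \<noteq> x" for i y
    using range[OF that, of i] by (auto simp: s_x)
  have cyc: "i mod 3 \<noteq> (i + 1) mod 3" "i mod 3 \<noteq> (i + 2) mod 3" "(i + 1) mod 3 \<noteq> (i + 2) mod 3"
    for i :: nat
    by presburger+
  have inj: "inj_on (s i) A" for i
  proof (rule inj_onI)
    fix y z assume yz: "y \<in> A" "z \<in> A" "s i y = s i z"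
    show "y = z"
    proof (cases "y = x \<or> z = x")
      case True
      then show ?thesis
        using x_above x_below yz by (metis less_irrefl)
    next
      \<comment> \<open>The two bands without \<open>x\<close> are disjoint; \<open>g\<close>
        separates the lower one and \<open>cyc\<close> the upper one.\<close>
      case False
      then show ?thesis
        using yz gm[of y] gm[of z] cyc[of i] inj_onD[OF g, of y z]
        by (auto simp: s_def split: if_splits)
    qed
  qed
  define P where "P = (\<lambda>i\<in>{1..6}. score_ballot A (s i))"
  have P: "P \<in> profiles A 6"
    unfolding P_def by (rule score_profile_in_profiles[OF inj])
  have W: "W 6 u v P = (\<Sum>i\<in>{1,2,3,4,5,6}. if s i v < s i u then 1 else 0)"
    if "u \<in> A" "v \<in> A" for u v
    unfolding P_def by (simp only: W_score_profile[OF inj that] card_filter_six)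
  \<comment> \<open>Three of the numbers 1..6 are odd and three are even.\<close>
  have tie: "W 6 x y P = W 6 y x P" if "y \<in> A" for y
  proof (cases "y = x")
    case False
    then show ?thesis
      using that mem by (simp add: W x_above x_below)
  qed simp
  \<comment> \<open>A strict defeat is needed, since a tied alternative could still win Condorcet's
    method.\<close>
  have beaten: "\<exists>z\<in>A. W 6 y z P < W 6 z y P" if y: "y \<in> A" "y \<noteq> x" for y
  proof -
    consider "y = a" | "y = b" | "y = c" | "y \<notin> {x, a, b, c}" using y by blast
    then show ?thesis
    proof cases
      case 1
      \<comment> \<open>\<open>b\<close> is above \<open>a\<close> unless i mod 3 = 2, hence wins
        four to two. In the same way \<open>c\<close> beats \<open>b\<close>, failing only at
        residue 1, and \<open>a\<close> beats \<open>c\<close>, failing only at residue 0.\<close>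
      have "W 6 a b P < W 6 b a P" using mem by (simp add: W s_a s_b)
      then show ?thesis using 1 mem by blast
    next
      case 2
      have "W 6 b c P < W 6 c b P" using mem by (simp add: W s_b s_c)
      then show ?thesis using 2 mem by blast
    next
      case 3
      have "W 6 c a P < W 6 a c P" using mem by (simp add: W s_a s_c)
      then show ?thesis using 3 mem by blast
    next
      case 4
      \<comment> \<open>Everything in the lowest band loses to \<open>a\<close> unanimously.\<close>
      have "s i y < s i a" for i using gm[OF y(1)] by (simp add: s_a s_other[OF 4])
      then have "W 6 y a P < W 6 a y P" using mem y by (simp add: W less_imp_not_less)
      then show ?thesis using mem by blast
    qed
  qed
  have "condorcet_winner A 6 P x"
    unfolding condorcet_winner_def condorcet_method_def
    using tie beaten mem by (force simp: not_le[symmetric])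
  moreover have "card {i \<in> {1..6}. ranks_last A (P i) x} = 3"
  proof -
    \<comment> \<open>For odd \<open>i\<close> the alternative \<open>a\<close> refutes the left
      side, so the range of \<open>y\<close> must not be empty.\<close>
    have "(\<forall>y\<in>A - {x}. s i x < s i y) \<longleftrightarrow> even i" for i
      using x_below mem dist by blast
    then have "{i \<in> {1..6}. ranks_last A (P i) x} = {i \<in> {1..6}. even i}"
      by (auto simp: P_def ranks_last_score_ballot[OF inj mem(1)])
    then show ?thesis by (simp only: card_filter_six) simp
  qed
  ultimately show ?thesis using that P mem by blast
qed

theorem theorem1:
  fixes A :: "'a set"
  assumes "finite A" and "card A \<ge> 4"
  shows "\<not> (\<exists>V. voting_procedure A V \<and> SDC A V \<and> CWC A V)"
proof
  assume "\<exists>V. voting_procedure A V \<and> SDC A V \<and> CWC A V"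
  then obtain V where SDC: "SDC A V" and CWC: "CWC A V" by blast
  obtain P x where P: "P \<in> profiles A 6" "x \<in> A" "condorcet_winner A 6 P x"
    and half: "card {i \<in> {1..6}. ranks_last A (P i) x} = 3"
    using condorcet_winner_half_last[OF assms] .
  have "V 6 P = {x}" using CWC P by (auto simp: CWC_def)
  \<comment> \<open>Three of six meets the bound n/2 with equality, which SDC admits.\<close>
  moreover have "real (card {i \<in> {1..6}. ranks_last A (P i) x}) \<ge> real 6 / 2"
    by (simp only: half)
  then have "x \<notin> V 6 P"
    using SDC P(1,2) unfolding SDC_def by (metis zero_less_numeral)
  ultimately show False by blast
qed

end
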